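(* Assume Martin's axiom for countable posets. Then there exists a hereditarily rapid ultrafilter $\mathcal{U}$ on $\omega$ such that $\mathcal{U}\cap\mathcal{W}=\emptyset$.
   Context: Martin's axiom for countable posets: for every countable partially ordered set $P$ and every family $\mathcal{D}$ of fewer than $\mathfrak{c}$ dense subsets of $P$, there is a filter on $P$ meeting every member of $\mathcal{D}$. A set $A\subseteq\omega$ is an AP-set if it contains arithmetic progressions of arbitrary finite length; the van der Waerden ideal $\mathcal{W}$ is the ideal of all subsets of $\omega$ that are not AP-sets. For an infinite $A\subseteq\omega$, its enumeration function $e_A$ is the unique strictly increasing function from $\omega$ onto $A$. A nonprincipal ultrafilter $\mathcal{U}$ on $\omega$ is rapid if the enumeration functions of sets in $\mathcal{U}$ form a dominating family in $({}^\omega\omega,\le^* )$, i.e. for every $h\in{}^\omega\omega$ there is $A\in\mathcal{U}$ with $h(n)\le e_A(n)$ for all but finitely many $n$. An ultrafilter $\mathcal{U}$ is hereditarily rapid if it is rapid and for every $f\in{}^\omega\omega$ the ultrafilter $f(\mathcal{U})$ generated by the sets $\{f[U]:U\in\mathcal{U}\}$ is again rapid.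
   Formalization: "Hereditarily rapid" is taken to require that f(U) be rapid only for those f for which f(U) is nonprincipal, since for constant f the ultrafilter f(U) is principal and so never rapid. *)

theory Defs
  imports Complex_Main "HOL-Library.Infinite_Set" "HOL-Library.Equipollence"
begin

text \<open>
  Posets are given by a carrier \<open>P\<close> and an order relation \<open>r\<close>, where \<open>(p, q) \<in> r\<close> means
  \<open>p \<le> q\<close>.  We use the forcing convention: dense sets are dense downwards, and filters are
  nonempty, upward closed and downward directed.
\<close>

definition dense_subset :: "'a set \<Rightarrow> 'a rel \<Rightarrow> 'a set \<Rightarrow> bool" where
  "dense_subset P r D \<longleftrightarrow> D \<subseteq> P \<and> (\<forall>p\<in>P. \<exists>d\<in>D. (d, p) \<in> r)"

definition poset_filter :: "'a set \<Rightarrow> 'a rel \<Rightarrow> 'a set \<Rightarrow> bool" where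
  "poset_filter P r G \<longleftrightarrow>
     G \<subseteq> P \<and> G \<noteq> {} \<and>
     (\<forall>p\<in>G. \<forall>q\<in>P. (p, q) \<in> r \<longrightarrow> q \<in> G) \<and>
     (\<forall>p\<in>G. \<forall>q\<in>G. \<exists>s\<in>G. (s, p) \<in> r \<and> (s, q) \<in> r)"

text \<open>
  A countable poset is isomorphic to one whose carrier is a set of natural numbers, so it
  suffices to quantify over those.  As usual for Martin's axiom, posets are nonempty (the empty
  poset has no nonempty filter).  The continuum is the cardinality of the power set of
  the natural numbers, so \<open>\<D> \<prec> (UNIV :: nat set set)\<close> says that \<open>\<D>\<close> has fewer
  than continuum many members.
\<close>

definition MA_countable :: bool where
  "MA_countable \<longleftrightarrow>
     (\<forall>(P :: nat set) r \<D>.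
        P \<noteq> {} \<and> partial_order_on P r \<and>
        \<D> \<prec> (UNIV :: nat set set) \<and> (\<forall>D\<in>\<D>. dense_subset P r D) \<longrightarrow>
        (\<exists>G. poset_filter P r G \<and> (\<forall>D\<in>\<D>. G \<inter> D \<noteq> {})))"

definition AP_set :: "nat set \<Rightarrow> bool" where
  "AP_set A \<longleftrightarrow> (\<forall>k. \<exists>a d. d > 0 \<and> (\<forall>i<k. a + i * d \<in> A))"

definition vdW_ideal :: "nat set set" where
  "vdW_ideal = {A. \<not> AP_set A}"

text \<open>
  Ultrafilters are values of the library type of filters; \<open>filter_sets\<close> recovers the
  corresponding family of sets.  The type also contains the improper filter \<open>bot\<close>.
\<close>

definition filter_sets :: "'a filter \<Rightarrow> 'a set set" where
  "filter_sets F = {A. eventually (\<lambda>x. x \<in> A) F}"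

definition ultrafilter :: "'a filter \<Rightarrow> bool" where
  "ultrafilter F \<longleftrightarrow> F \<noteq> bot \<and> (\<forall>A. A \<in> filter_sets F \<or> - A \<in> filter_sets F)"

definition nonprincipal :: "'a filter \<Rightarrow> bool" where
  "nonprincipal F \<longleftrightarrow> \<not> (\<exists>x. F = principal {x})"

text \<open>The image ultrafilter is \<^const>\<open>filtermap\<close>: it is generated by the images of the members.\<close>

lemma filter_sets_filtermap:
  "filter_sets (filtermap f F) = {B. \<exists>A\<in>filter_sets F. f ` A \<subseteq> B}"
proof -
  have "(\<forall>\<^sub>F x in F. f x \<in> B) \<longleftrightarrow> (\<exists>A. (\<forall>\<^sub>F x in F. x \<in> A) \<and> f ` A \<subseteq> B)" for B
  proof
    assume "\<forall>\<^sub>F x in F. f x \<in> B"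
    then show "\<exists>A. (\<forall>\<^sub>F x in F. x \<in> A) \<and> f ` A \<subseteq> B"
      by (intro exI[of _ "{x. f x \<in> B}"]) auto
  next
    assume "\<exists>A. (\<forall>\<^sub>F x in F. x \<in> A) \<and> f ` A \<subseteq> B"
    then show "\<forall>\<^sub>F x in F. f x \<in> B"
      by (auto elim!: eventually_mono)
  qed
  then show ?thesis
    by (auto simp: filter_sets_def eventually_filtermap)
qed

text \<open>
  For infinite \<open>A\<close>, the enumeration function of \<open>A\<close> is \<^term>\<open>enumerate A\<close>.
\<close>

definition rapid :: "nat filter \<Rightarrow> bool" where
  "rapid U \<longleftrightarrow> ultrafilter U \<and> nonprincipal U \<and>
     (\<forall>h :: nat \<Rightarrow> nat. \<exists>A \<in> filter_sets U. infinite A \<and>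
        (\<forall>\<^sub>F n in sequentially. h n \<le> enumerate A n))"

text \<open>
  The image of an ultrafilter under a function that is constant on one of its members is
  principal, hence never rapid; the requirement therefore concerns the nonprincipal images.
\<close>

definition hereditarily_rapid :: "nat filter \<Rightarrow> bool" where
  "hereditarily_rapid U \<longleftrightarrow> rapid U \<and>
     (\<forall>f :: nat \<Rightarrow> nat. nonprincipal (filtermap f U) \<longrightarrow> rapid (filtermap f U))"

end

theory Submission
  imports Defs "HOL-Algebra.Free_Abelian_Groups"
begin

text \<open>
  Enumerate all pairs \<open>(f, h)\<close> of functions in order type continuum and choose sets \<open>A\<close>, one for
  each pair, such that all finite intersections are AP-sets, and such that \<open>f\<close> is constant on \<open>A\<close>
  or \<open>f ` A\<close> is so sparse that its enumeration dominates \<open>h\<close>.  If no fibre of \<open>f\<close> is compatible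
  with the sets chosen so far, then by van der Waerden's theorem each of them still is an AP-set
  after removing the points with small \<open>f\<close>-value.  Hence Martin's axiom, applied to the finite sets
  with sparse image ordered by inclusion, yields \<open>A\<close>.  The pairs where \<open>f\<close> is an indicator function
  and \<open>h\<close> is constantly \<open>2\<close> make the generated filter an ultrafilter.
\<close>

subsection \<open>Van der Waerden's theorem\<close>

text \<open>The progressions of \<open>vdW_bound\<close> have length \<open>k\<close>, but their next term is required to lie below
  the bound as well: it is the focus in the colour-focusing argument.\<close>

definition mono_AP :: "nat \<Rightarrow> (nat \<Rightarrow> nat) \<Rightarrow> nat \<Rightarrow> nat \<Rightarrow> nat \<Rightarrow> bool" where
  "mono_AP k c q a d \<longleftrightarrow> d > 0 \<and> (\<forall>i<k. c (a + i * d) = q)"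

definition vdW_bound :: "nat \<Rightarrow> nat \<Rightarrow> nat \<Rightarrow> bool" where
  "vdW_bound k r N \<longleftrightarrow>
     (\<forall>c. (\<forall>i. c i < r) \<longrightarrow> (\<exists>q a d. mono_AP k c q a d \<and> a + k * d < N))"

text \<open>A block of length \<open>M\<close> carries one of finitely many words over
  \<open>r\<close> colours, so colouring the blocks by their words is a finite colouring to which
  the bound for length \<open>k\<close> applies. Only the first \<open>k\<close> blocks agree; block
  \<open>a + k * d\<close> is merely kept below \<open>N\<close>, as the place for a focus.\<close>

lemma vdW_block_colouring:
  assumes vdW: "\<And>r. \<exists>N. vdW_bound k r N"
  shows "\<exists>N. \<forall>c :: nat \<Rightarrow> nat. (\<forall>i. c i < r) \<longrightarrow>
    (\<exists>a d. d > 0 \<and> a + k * d < N \<and> (\<forall>i<k. \<forall>j<M. c ((a + i * d) * M + j) = c (a * M + j)))"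
proof -
  let ?L = "{xs. set xs \<subseteq> {..<r} \<and> length xs = M}"
  have fin: "finite ?L"
    by (rule finite_lists_length_eq) simp
  \<comment> \<open>\<open>\<phi>\<close> numbers the words, since \<open>vdW_bound\<close> takes
    natural numbers as colours.\<close>
  obtain \<phi> where \<phi>: "bij_betw \<phi> ?L {0..<card ?L}"
    using ex_bij_betw_finite_nat[OF fin] by blast
  obtain N where N: "vdW_bound k (card ?L) N"
    using vdW by blast
  show ?thesis
  proof (rule exI[of _ N], intro allI impI)
    fix c :: "nat \<Rightarrow> nat"
    assume c: "\<forall>i. c i < r"
    define w where "w b = map (\<lambda>j. c (b * M + j)) [0..<M]" for b
    have w: "w b \<in> ?L" for b
      using c by (auto simp: w_def)
    have "\<phi> (w b) < card ?L" for b
      using bij_betwE[OF \<phi>] w by fastforce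
    then obtain q a d where q: "mono_AP k (\<lambda>b. \<phi> (w b)) q a d" "a + k * d < N"
      using N[unfolded vdW_bound_def, rule_format, of "\<lambda>b. \<phi> (w b)"] by blast
    have "c ((a + i * d) * M + j) = c (a * M + j)" if "i < k" "j < M" for i j
    proof -
      have "\<phi> (w (a + i * d)) = q" "\<phi> (w (a + 0 * d)) = q"
        using q(1) that unfolding mono_AP_def by (blast, metis gr_zeroI not_less_zero)
      then have "w (a + i * d) = w a"
        using inj_onD[OF bij_betw_imp_inj_on[OF \<phi>] _ w w] by (metis add_0_right mult_0)
      then have "w (a + i * d) ! j = w a ! j"
        by simp
      then show ?thesis
        using that by (simp add: w_def)
    qed
    then show "\<exists>a d. d > 0 \<and> a + k * d < N \<and>
        (\<forall>i<k. \<forall>j<M. c ((a + i * d) * M + j) = c (a * M + j))"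
      using q unfolding mono_AP_def by blast
  qed
qed

lemma mono_AP_shift: "mono_AP k (\<lambda>x. c (m + x)) q a d \<longleftrightarrow> mono_AP k c q (m + a) d"
  by (simp add: mono_AP_def add.assoc)

lemma mono_AP_Suc: "mono_AP (Suc k) c q a d \<longleftrightarrow> mono_AP k c q a d \<and> c (a + k * d) = q"
  by (auto simp: mono_AP_def less_Suc_eq)

text \<open>Either a progression of length \<open>k + 1\<close> is monochromatic, or \<open>s\<close> monochromatic
  progressions of length \<open>k\<close> with distinct colours share the same next term \<open>f\<close>.\<close>

lemma vdW_focus:
  assumes vdW: "\<And>r. \<exists>N. vdW_bound k r N"
  shows "\<exists>N. \<forall>c. (\<forall>i. c i < r) \<longrightarrow>
    (\<exists>q a d. mono_AP (Suc k) c q a d \<and> a + k * d < N) \<or>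
    (\<exists>f<N. \<exists>S. finite S \<and> card S = s \<and> (\<forall>q\<in>S. \<exists>a d. mono_AP k c q a d \<and> a + k * d = f))"
proof (induction s)
  case 0
  show ?case
    by (rule exI[of _ 1]) (auto intro!: exI[of _ "{}"])
next
  case (Suc s)
  then obtain M where M: "\<And>c. (\<forall>i. c i < r) \<Longrightarrow>
    (\<exists>q a d. mono_AP (Suc k) c q a d \<and> a + k * d < M) \<or>
    (\<exists>f<M. \<exists>S. finite S \<and> card S = s \<and> (\<forall>q\<in>S. \<exists>a d. mono_AP k c q a d \<and> a + k * d = f))"
    by blast
  obtain N where N: "\<And>c. (\<forall>i. c i < r) \<Longrightarrow>
    (\<exists>a d. d > 0 \<and> a + k * d < N \<and> (\<forall>i<k. \<forall>j<M. c ((a + i * d) * M + j) = c (a * M + j)))"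
    using vdW_block_colouring[OF vdW, where M=M and r=r] by auto
  show ?case
  proof (rule exI[of _ "N * M"], intro allI impI)
    fix c :: "nat \<Rightarrow> nat"
    assume c: "\<forall>i. c i < r"
    \<comment> \<open>The blocks \<open>A + i * D\<close> with \<open>i < k\<close> are coloured
      alike; block \<open>A + k * D\<close> will contain the new focus.\<close>
    obtain A D where D: "D > 0" "A + k * D < N"
      and per: "\<And>i j. i < k \<Longrightarrow> j < M \<Longrightarrow> c ((A + i * D) * M + j) = c (A * M + j)"
      using N[OF c] by blast
    have bound: "(A + k * D) * M + j < N * M" if "j < M" for j
    proof -
      have "(A + k * D) * M + j < (A + k * D) * M + M"
        using that by simp
      also have "\<dots> = Suc (A + k * D) * M"
        by simp
      also have "\<dots> \<le> N * M"
        using D(2) by (intro mult_le_mono1) simp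
      finally show ?thesis .
    qed
    \<comment> \<open>The induction hypothesis is applied inside block \<open>A\<close>, so
      \<open>a\<close> and \<open>f\<close> are positions relative to its start
      \<open>A * M\<close>.\<close>
    consider (mono) q a d where "mono_AP (Suc k) c q (A * M + a) d" "a + k * d < M"
      | (foc) f S where "f < M" "finite S" "card S = s"
          "\<And>q. q \<in> S \<Longrightarrow> \<exists>a d. mono_AP k c q (A * M + a) d \<and> a + k * d = f"
      using M[of "\<lambda>x. c (A * M + x)"] c by (auto simp: mono_AP_shift)
    then show "(\<exists>q a d. mono_AP (Suc k) c q a d \<and> a + k * d < N * M) \<or>
      (\<exists>f<N * M. \<exists>S. finite S \<and> card S = Suc s \<and>
         (\<forall>q\<in>S. \<exists>a d. mono_AP k c q a d \<and> a + k * d = f))"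
    proof cases
      case mono
      then show ?thesis
        using bound[OF mono(2)] by (intro disjI1 exI[of _ q] exI[of _ "A * M + a"] exI[of _ d])
          (simp add: algebra_simps)
    next
      case foc
      let ?q = "c (A * M + f)" and ?F = "(A + k * D) * M + f"
      show ?thesis
      \<comment> \<open>If the focus has a colour from \<open>S\<close>, it extends the progression
        of that colour. Otherwise its colour is new, and \<open>?F\<close>, its copy in block
        \<open>A + k * D\<close>, becomes a focus for \<open>s + 1\<close> colours.\<close>
      proof (cases "?q \<in> S")
        case True
        then obtain a d where a: "mono_AP k c ?q (A * M + a) d" "a + k * d = f"
          using foc(4) by blast
        then have "mono_AP (Suc k) c ?q (A * M + a) d"
          by (simp add: mono_AP_Suc add.assoc)
        moreover have "A * M + a + k * d < N * M"
          using bound[OF foc(1)] a(2) by (simp add: algebra_simps)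
        ultimately show ?thesis
          by blast
      next
        case False
        have "\<exists>a d. mono_AP k c q a d \<and> a + k * d = ?F" if q: "q \<in> insert ?q S" for q
        proof (cases "q = ?q")
          case True
          \<comment> \<open>The copies of the old focus in the first \<open>k\<close> blocks form
            the progression of the new colour.\<close>
          have eq: "A * M + f + i * (D * M) = (A + i * D) * M + f" for i
            by (simp add: algebra_simps)
          have "D * M > 0"
            using foc(1) D(1) by simp
          moreover have "\<forall>i<k. c (A * M + f + i * (D * M)) = q"
            unfolding eq True using per[OF _ foc(1)] by blast
          ultimately have "mono_AP k c q (A * M + f) (D * M)"
            unfolding mono_AP_def by blast
          then show ?thesis
            by (intro exI[of _ "A * M + f"] exI[of _ "D * M"]) (simp add: algebra_simps)
        next
          case False
          then obtain a d where a: "mono_AP k c q (A * M + a) d" "a + k * d = f"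
            using foc(4)[of q] q False by blast
          \<comment> \<open>An old progression is spread over the blocks, its \<open>i\<close>-th
            term being moved to block \<open>A + i * D\<close>; this keeps the colours and moves the
            focus to \<open>?F\<close>.\<close>
          have "c (A * M + a + i * (d + D * M)) = q" if "i < k" for i
          proof -
            have eq: "A * M + a + i * (d + D * M) = (A + i * D) * M + (a + i * d)"
              by (simp add: algebra_simps)
            have "a + i * d < M"
              using a foc(1) that by (metis add_left_mono le_less_trans less_imp_le mult_le_mono1)
            then show ?thesis
              unfolding eq using a(1) per[OF that] that by (simp add: mono_AP_def add.assoc)
          qed
          then have "mono_AP k c q (A * M + a) (d + D * M)"
            using a(1) by (simp add: mono_AP_def)
          then show ?thesis
            using a(2) by (intro exI[of _ "A * M + a"] exI[of _ "d + D * M"])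
              (auto simp: algebra_simps)
        qed
        then show ?thesis
          using foc(2,3) False bound[OF foc(1)]
          by (intro disjI2 exI[of _ ?F] conjI exI[of _ "insert ?q S"]) auto
      qed
    qed
  qed
qed

text \<open>With \<open>s = r\<close> in \<open>vdW_focus\<close> the focused progressions use up
  all \<open>r\<close> colours, so the common focus extends one of them.\<close>

theorem van_der_Waerden: "\<exists>N. vdW_bound k r N"
proof (induction k arbitrary: r)
  case 0
  show ?case
  proof -
    have "mono_AP 0 c 0 0 1 \<and> 0 + 0 * 1 < (1::nat)" for c
      by (simp add: mono_AP_def)
    then show ?thesis
      unfolding vdW_bound_def by blast
  qed
next
  case (Suc k)
  show ?case
  \<comment> \<open>Positive \<open>k\<close> is needed below: an empty progression has every
    colour, also those not below \<open>r\<close>, and gives no bound on its difference.\<close>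
  proof (cases k)
    case 0
    show ?thesis
    proof -
      have "mono_AP (Suc k) c (c 0) 0 1 \<and> 0 + Suc k * 1 < (2::nat)" for c
        by (simp add: mono_AP_def 0)
      then show ?thesis
        unfolding vdW_bound_def by blast
    qed
  next
    case k: (Suc k')
    obtain N where N: "\<forall>c. (\<forall>i. c i < r) \<longrightarrow>
      (\<exists>q a d. mono_AP (Suc k) c q a d \<and> a + k * d < N) \<or>
      (\<exists>f<N. \<exists>S. finite S \<and> card S = r \<and> (\<forall>q\<in>S. \<exists>a d. mono_AP k c q a d \<and> a + k * d = f))"
      using vdW_focus[OF Suc, of r r] ..
    have "\<exists>q a d. mono_AP (Suc k) c q a d \<and> a + Suc k * d < 2 * N" if c: "\<forall>i. c i < r" for c
    proof -
      have "\<exists>q a d. mono_AP (Suc k) c q a d \<and> a + k * d < N"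
        using N[rule_format, OF c[rule_format]]
      proof
        assume "\<exists>f<N. \<exists>S. finite S \<and> card S = r \<and>
          (\<forall>q\<in>S. \<exists>a d. mono_AP k c q a d \<and> a + k * d = f)"
        then show ?thesis
        proof (elim exE conjE)
          fix f S
          assume f: "f < N" and S: "finite S" "card S = r"
            and foc: "\<forall>q\<in>S. \<exists>a d. mono_AP k c q a d \<and> a + k * d = f"
          have "S \<subseteq> {..<r}"
          proof
            fix q assume "q \<in> S"
            then obtain a d where "mono_AP k c q a d"
              using foc by blast
            then have "c (a + 0 * d) = q"
              unfolding mono_AP_def k by blast
            then show "q \<in> {..<r}"
              using c by auto
          qed
          then have "S = {..<r}"
            using S by (intro card_subset_eq) auto
          then obtain a d where "mono_AP k c (c f) a d" "a + k * d = f"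
            using foc c by blast
          then show ?thesis
            using f by (metis mono_AP_Suc)
        qed
      qed
      then obtain q a d where q: "mono_AP (Suc k) c q a d" "a + k * d < N"
        by blast
      \<comment> \<open>The bound is doubled to make room for one more term after the
        \<open>k + 1\<close> found: its distance \<open>d\<close> is below \<open>N\<close> as
        well.\<close>
      have "d \<le> k * d"
        by (simp add: k)
      then have "a + Suc k * d < 2 * N"
        using q(2) unfolding mult_Suc by linarith
      then show ?thesis
        using q(1) by blast
    qed
    then show ?thesis
      unfolding vdW_bound_def by blast
  qed
qed

subsection \<open>Sets containing long progressions\<close>

lemma AP_set_mono: "AP_set A \<Longrightarrow> A \<subseteq> B \<Longrightarrow> AP_set B"
  unfolding AP_set_def by (meson subsetD)

lemma AP_set_UNIV: "AP_set UNIV"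
  by (auto simp: AP_set_def)

lemma not_AP_set_empty: "\<not> AP_set {}"
  by (auto simp: AP_set_def)

lemma not_AP_set_singleton: "\<not> AP_set {x}"
proof
  assume "AP_set {x}"
  then obtain a d where d: "d > 0" and a: "\<And>i. i < 2 \<Longrightarrow> a + i * d \<in> {x}"
    unfolding AP_set_def by meson
  show False
    using a[of 0] a[of 1] d by simp
qed

text \<open>Partition regularity: van der Waerden's theorem is applied to the indices of a long
  progression in \<open>A \<union> B\<close>, coloured by membership in \<open>A\<close>.\<close>

lemma AP_set_Un:
  assumes AB: "AP_set (A \<union> B)"
  shows "AP_set A \<or> AP_set B"
proof (rule ccontr)
  assume "\<not> ?thesis"
  then obtain k l where k: "\<And>a d. d > 0 \<Longrightarrow> \<exists>i<k. a + i * d \<notin> A"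
    and l: "\<And>a d. d > 0 \<Longrightarrow> \<exists>i<l. a + i * d \<notin> B"
    unfolding AP_set_def by meson
  obtain N where N: "vdW_bound (max k l) 2 N"
    using van_der_Waerden by blast
  obtain a d where d: "d > 0" and a: "\<And>i. i < N \<Longrightarrow> a + i * d \<in> A \<union> B"
    using AB unfolding AP_set_def by meson
  \<comment> \<open>Colour 1 guarantees membership in \<open>B\<close> only for indices below
    \<open>N\<close>, which is why \<open>lt'\<close> is proved.\<close>
  define c :: "nat \<Rightarrow> nat" where "c i = (if a + i * d \<in> A then 0 else 1)" for i
  have "\<forall>i. c i < 2"
    by (simp add: c_def)
  then obtain q x e where e: "e > 0" and lt: "x + max k l * e < N"
    and q: "\<And>i. i < max k l \<Longrightarrow> c (x + i * e) = q"
    using N unfolding vdW_bound_def mono_AP_def by blast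
  have eq: "a + (x + i * e) * d = (a + x * d) + i * (e * d)" for i
    by (simp add: algebra_simps)
  have lt': "x + i * e < N" if "i < max k l" for i
  proof -
    have "i * e \<le> max k l * e"
      using that by (intro mult_le_mono1) simp
    then show ?thesis
      using lt by linarith
  qed
  show False
  proof (cases "q = 0")
    case True
    obtain i where "i < k" "(a + x * d) + i * (e * d) \<notin> A"
      using k[of "e * d" "a + x * d"] d e by auto
    then show False
      using q[of i] True by (simp add: c_def eq less_max_iff_disj)
  next
    case False
    obtain i where i: "i < l" "(a + x * d) + i * (e * d) \<notin> B"
      using l[of "e * d" "a + x * d"] d e by auto
    then show False
      using q[of i] False a[OF lt', of i] by (simp add: c_def eq less_max_iff_disj split: if_splits)
  qed
qed

lemma AP_set_UN:
  assumes "finite I" "AP_set (\<Union>i\<in>I. A i)"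
  shows "\<exists>i\<in>I. AP_set (A i)"
  using assms by (induction I rule: finite_induct) (auto simp: not_AP_set_empty dest: AP_set_Un)

subsection \<open>Sparse sets\<close>

text \<open>Expresses by counting that the \<open>n\<close>-th element, counted from 0, is at least
  \<open>h n\<close>. In this form it makes sense for finite sets too, which serve as forcing
  conditions.\<close>

definition sparse :: "(nat \<Rightarrow> nat) \<Rightarrow> nat set \<Rightarrow> bool" where
  "sparse h B \<longleftrightarrow> (\<forall>n. card (B \<inter> {..<h n}) \<le> n)"

text \<open>If the \<open>n\<close>-th element were below \<open>h n\<close>, then so would be all
  \<open>n + 1\<close> elements up to it.\<close>

lemma sparse_le_enumerate:
  assumes "sparse h B" "infinite B"
  shows "h n \<le> enumerate B n"
proof (rule ccontr)
  assume "\<not> ?thesis"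
  then have less: "enumerate B n < h n"
    by simp
  have "enumerate B ` {..n} \<subseteq> B \<inter> {..<h n}"
  proof clarify
    fix i
    assume "i \<le> n"
    then have "enumerate B i \<le> enumerate B n"
      using assms(2) by (simp add: enumerate_mono_le_iff)
    then show "enumerate B i \<in> B \<inter> {..<h n}"
      using less assms(2) by (simp add: enumerate_in_set le_less_trans del: enumerate_mono_le_iff)
  qed
  then have "card (enumerate B ` {..n}) \<le> card (B \<inter> {..<h n})"
    by (intro card_mono) auto
  moreover have "inj_on (enumerate B) {..n}"
    using strict_mono_enumerate[OF assms(2)] by (meson inj_on_subset strict_mono_imp_inj_on subset_UNIV)
  then have "card (enumerate B ` {..n}) = Suc n"
    by (simp add: card_image)
  ultimately show False
    using assms(1) by (metis Suc_n_not_le_n le_trans sparse_def)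
qed

text \<open>For \<open>n\<close> below \<open>card B + k\<close> the new points are too large to be
  counted; from there on the whole union has at most \<open>n\<close> elements.\<close>

lemma sparse_Un:
  assumes "sparse h B" "finite B" "finite C" "card C \<le> k"
    and large: "\<And>x n. x \<in> C \<Longrightarrow> n < card B + k \<Longrightarrow> h n \<le> x"
  shows "sparse h (B \<union> C)"
  unfolding sparse_def
proof
  fix n
  show "card ((B \<union> C) \<inter> {..<h n}) \<le> n"
  proof (cases "n < card B + k")
    case True
    have "x \<notin> C" if "x < h n" for x
      using large[OF _ True, of x] that by (simp add: not_le[symmetric]) blast
    then have "(B \<union> C) \<inter> {..<h n} = B \<inter> {..<h n}"
      by blast
    then show ?thesis
      using assms(1) by (simp add: sparse_def)
  next
    case False
    have "card ((B \<union> C) \<inter> {..<h n}) \<le> card (B \<union> C)"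
      using assms by (intro card_mono) auto
    also have "\<dots> \<le> card B + card C"
      by (rule card_Un_le)
    finally show ?thesis
      using False assms(4) by simp
  qed
qed

text \<open>Each instance of sparsity concerns a finite part of the union, and by directedness a
  single member covers that part.\<close>

lemma sparse_directed_Union:
  assumes "\<G> \<noteq> {}" "\<And>B. B \<in> \<G> \<Longrightarrow> sparse h B"
    and dir: "\<And>B C. B \<in> \<G> \<Longrightarrow> C \<in> \<G> \<Longrightarrow> \<exists>E\<in>\<G>. B \<union> C \<subseteq> E"
  shows "sparse h (\<Union>\<G>)"
  unfolding sparse_def
proof
  fix n
  have "\<exists>B\<in>\<G>. F \<subseteq> B" if "finite F" "F \<subseteq> \<Union>\<G>" for F
    using that
  proof (induction F rule: finite_induct)
    case empty
    then show ?case
      using assms(1) by blast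
  next
    case (insert x F)
    then obtain B C where "B \<in> \<G>" "F \<subseteq> B" "C \<in> \<G>" "x \<in> C"
      by auto
    then show ?case
      using dir[of B C] by blast
  qed
  then obtain B where "B \<in> \<G>" "\<Union>\<G> \<inter> {..<h n} \<subseteq> B"
    by (meson Int_lower1 finite_Int finite_lessThan)
  then have "card (\<Union>\<G> \<inter> {..<h n}) \<le> card (B \<inter> {..<h n})"
    by (intro card_mono) auto
  also have "\<dots> \<le> n"
    using assms(2) \<open>B \<in> \<G>\<close> by (simp add: sparse_def)
  finally show "card (\<Union>\<G> \<inter> {..<h n}) \<le> n" .
qed

subsection \<open>Adding a set by Martin's axiom\<close>

text \<open>Intersecting finitely many members gives \<open>Y\<close> in which no fibre over a value
  below \<open>M\<close> is an AP-set. By partition regularity the rest of \<open>Y\<close> is one.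
  This supplies the points for the density argument.\<close>

lemma large_fibres_AP_set:
  fixes f :: "nat \<Rightarrow> nat"
  assumes Int: "\<And>X Y. X \<in> \<F> \<Longrightarrow> Y \<in> \<F> \<Longrightarrow> X \<inter> Y \<in> \<F>"
    and AP: "\<And>X. X \<in> \<F> \<Longrightarrow> AP_set X"
    and fibre: "\<And>k. \<exists>X\<in>\<F>. \<not> AP_set (f -` {k} \<inter> X)"
    and X: "X \<in> \<F>"
  shows "AP_set (X \<inter> {x. M \<le> f x})"
proof -
  have "\<exists>Y\<in>\<F>. Y \<subseteq> X \<and> (\<forall>k<M. \<not> AP_set (f -` {k} \<inter> Y))"
  proof (induction M)
    case 0
    then show ?case
      using X by blast
  next
    case (Suc M)
    then obtain Y Z where "Y \<in> \<F>" "Y \<subseteq> X" and Y: "\<forall>k<M. \<not> AP_set (f -` {k} \<inter> Y)"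
      and "Z \<in> \<F>" and Z: "\<not> AP_set (f -` {M} \<inter> Z)"
      using fibre by blast
    have "\<forall>k<Suc M. \<not> AP_set (f -` {k} \<inter> (Y \<inter> Z))"
    proof (intro allI impI notI)
      fix k
      assume "k < Suc M" and AP: "AP_set (f -` {k} \<inter> (Y \<inter> Z))"
      then show False
        using Y Z AP_set_mono[OF AP, of "f -` {k} \<inter> Y"] AP_set_mono[OF AP, of "f -` {k} \<inter> Z"]
        by (auto simp: less_Suc_eq)
    qed
    then show ?case
      using Int \<open>Y \<in> \<F>\<close> \<open>Z \<in> \<F>\<close> \<open>Y \<subseteq> X\<close> by (intro bexI[of _ "Y \<inter> Z"]) auto
  qed
  then obtain Y where "Y \<in> \<F>" "Y \<subseteq> X" and Y: "\<forall>k<M. \<not> AP_set (f -` {k} \<inter> Y)"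
    by blast
  have "Y = (\<Union>k\<in>{..<M}. f -` {k} \<inter> Y) \<union> (Y \<inter> {x. M \<le> f x})"
    by auto
  then have "AP_set (\<Union>k\<in>{..<M}. f -` {k} \<inter> Y) \<or> AP_set (Y \<inter> {x. M \<le> f x})"
    using AP[OF \<open>Y \<in> \<F>\<close>] AP_set_Un by metis
  then have "AP_set (Y \<inter> {x. M \<le> f x})"
    using AP_set_UN[of "{..<M}" "\<lambda>k. f -` {k} \<inter> Y"] Y by blast
  then show ?thesis
    using \<open>Y \<subseteq> X\<close> by (elim AP_set_mono) auto
qed

text \<open>Bounds the number of dense sets, which are indexed by a member of the family and a
  length.\<close>

lemma lesspoll_Times_nat:
  assumes "\<F> \<prec> (UNIV :: nat set set)"
  shows "\<F> \<times> (UNIV :: nat set) \<prec> (UNIV :: nat set set)"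
proof (cases "finite \<F>")
  case True
  then have "countable (\<F> \<times> (UNIV :: nat set))"
    by (simp add: countable_finite)
  then have "\<F> \<times> (UNIV :: nat set) \<lesssim> (UNIV :: nat set)"
    by (auto simp: countable_def lepoll_def)
  also have "(UNIV :: nat set) \<prec> Pow (UNIV :: nat set)"
    by (rule lesspoll_Pow_self)
  finally show ?thesis
    by simp
next
  case False
  then have "(UNIV :: nat set) \<lesssim> \<F>"
    using infinite_le_lepoll by blast
  then have "\<F> \<times> (UNIV :: nat set) \<lesssim> \<F> \<times> \<F>"
    by (intro times_lepoll_mono) auto
  also have "\<F> \<times> \<F> \<approx> \<F>"
    using False card_of_Times_same_infinite eqpoll_iff_card_of_ordIso by blast
  finally show ?thesis
    using assms lesspoll_trans1 by blast
qed

text \<open>One stage of the construction. A fibre meeting every member of \<open>\<F>\<close> in an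
  AP-set serves as \<open>A\<close> at once; otherwise \<open>A\<close> is the union of a generic
  filter of finite sets.\<close>

lemma MA_countable_extension:
  fixes f h :: "nat \<Rightarrow> nat"
  assumes MA: "MA_countable" and small: "\<F> \<prec> (UNIV :: nat set set)"
    and Int: "\<And>X Y. X \<in> \<F> \<Longrightarrow> Y \<in> \<F> \<Longrightarrow> X \<inter> Y \<in> \<F>"
    and AP: "\<And>X. X \<in> \<F> \<Longrightarrow> AP_set X"
  shows "\<exists>A. (\<forall>X\<in>\<F>. AP_set (A \<inter> X)) \<and> ((\<exists>k. A \<subseteq> f -` {k}) \<or> sparse h (f ` A))"
proof (cases "\<exists>k. \<forall>X\<in>\<F>. AP_set (f -` {k} \<inter> X)")
  case True
  then show ?thesis
    by blast
next
  case False
  \<comment> \<open>Finite sets are coded by natural numbers, as \<open>MA_countable\<close>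
    requires; larger sets are stronger conditions. Meeting \<open>D (X, k)\<close> puts a
    progression of length \<open>k\<close> from \<open>X\<close> into the generic set.\<close>
  define P where "P = {p. sparse h (f ` set_decode p)}"
  define r where "r = {(p, q). p \<in> P \<and> q \<in> P \<and> set_decode q \<subseteq> set_decode p}"
  define D where
    "D = (\<lambda>(X, k). {p \<in> P. \<exists>a d. d > 0 \<and> (\<forall>i<k. a + i * d \<in> set_decode p \<inter> X)})"
  have nonempty: "P \<noteq> {}"
  proof -
    have "0 \<in> P"
      by (simp add: P_def sparse_def)
    then show ?thesis
      by blast
  qed
  have po: "partial_order_on P r"
    unfolding partial_order_on_def preorder_on_def
  proof (intro conjI)
    show "r \<subseteq> P \<times> P" "refl_on P r" "trans r"
      by (auto simp: r_def refl_on_def trans_def)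
    show "antisym r"
    proof (rule antisymI)
      fix p q
      assume "(p, q) \<in> r" "(q, p) \<in> r"
      then have "set_decode p = set_decode q"
        by (auto simp: r_def)
      then show "p = q"
        by (metis set_decode_inverse)
    qed
  qed
  have few: "D ` (\<F> \<times> UNIV) \<prec> (UNIV :: nat set set)"
    by (rule lesspoll_trans1[OF image_lepoll lesspoll_Times_nat[OF small]])
  have dense: "dense_subset P r (D (X, k))" if X: "X \<in> \<F>" for X k
    unfolding dense_subset_def
  proof (intro conjI ballI)
    show "D (X, k) \<subseteq> P"
      by (auto simp: D_def)
    fix p
    assume p: "p \<in> P"
    \<comment> \<open>Adding \<open>k\<close> points adds at most \<open>k\<close> values of
      \<open>f\<close>, so by \<open>sparse_Un\<close> only the bounds \<open>h m\<close> with
      \<open>m < n\<close> matter. The sum of these bounds exceeds or equals each of them.\<close>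
    define n where "n = card (f ` set_decode p) + k"
    have "AP_set (X \<inter> {x. sum h {..<n} \<le> f x})"
      using large_fibres_AP_set[of \<F>] Int AP X False by blast
    then have "\<exists>a d. d > 0 \<and> (\<forall>i<k. a + i * d \<in> X \<inter> {x. sum h {..<n} \<le> f x})"
      unfolding AP_set_def by (rule spec)
    then obtain a d where d: "d > 0"
      and "\<forall>i<k. a + i * d \<in> X \<inter> {x. sum h {..<n} \<le> f x}"
      by (elim exE conjE)
    then have a: "\<And>i. i < k \<Longrightarrow> a + i * d \<in> X"
      "\<And>i. i < k \<Longrightarrow> sum h {..<n} \<le> f (a + i * d)"
      by blast+
    define S where "S = (\<lambda>i. a + i * d) ` {..<k}"
    have S: "finite S"
      unfolding S_def by (intro finite_imageI finite_lessThan)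
    have card: "card (f ` S) \<le> k"
      unfolding S_def image_image by (rule order_trans[OF card_image_le]) simp_all
    have large: "h m \<le> x" if x: "x \<in> f ` S" and m: "m < n" for x m
    proof -
      obtain i where "i < k" "x = f (a + i * d)"
        using x unfolding S_def by blast
      moreover have "h m \<le> sum h {..<n}"
        using m by (intro member_le_sum) auto
      ultimately show ?thesis
        using a(2) order_trans by blast
    qed
    have "sparse h (f ` set_decode p)"
      using p by (simp add: P_def)
    then have "sparse h (f ` set_decode p \<union> f ` S)"
      using large unfolding n_def
      by (rule sparse_Un[OF _ finite_imageI[OF finite_set_decode] finite_imageI[OF S] card])
    then have inP: "set_encode (set_decode p \<union> S) \<in> P"
      using S by (simp add: P_def image_Un)
    have "\<forall>i<k. a + i * d \<in> (set_decode p \<union> S) \<inter> X"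
      using a(1) unfolding S_def by blast
    then have "\<exists>a d. d > 0 \<and> (\<forall>i<k. a + i * d \<in> set_decode (set_encode (set_decode p \<union> S)) \<inter> X)"
      unfolding set_encode_inverse[OF finite_UnI[OF finite_set_decode S]] using d by blast
    then have "set_encode (set_decode p \<union> S) \<in> D (X, k)"
      unfolding D_def using inP by simp
    moreover have "(set_encode (set_decode p \<union> S), p) \<in> r"
      using p S inP by (simp add: r_def)
    ultimately show "\<exists>q\<in>D (X, k). (q, p) \<in> r"
      by blast
  qed
  have "\<forall>E\<in>D ` (\<F> \<times> UNIV). dense_subset P r E"
    using dense by auto
  then obtain G where G: "poset_filter P r G" and meets: "\<forall>E\<in>D ` (\<F> \<times> UNIV). G \<inter> E \<noteq> {}"
    using MA[unfolded MA_countable_def, THEN spec, THEN spec, THEN spec, THEN mp,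
        OF conjI[OF nonempty conjI[OF po conjI[OF few]]]] by blast
  define A where "A = \<Union>(set_decode ` G)"
  have "sparse h (\<Union>((\<lambda>p. f ` set_decode p) ` G))"
  proof (rule sparse_directed_Union)
    show "(\<lambda>p. f ` set_decode p) ` G \<noteq> {}"
      using G by (auto simp: poset_filter_def)
    show "sparse h B" if "B \<in> (\<lambda>p. f ` set_decode p) ` G" for B
      using that G by (auto simp: poset_filter_def P_def)
    show "\<exists>E\<in>(\<lambda>p. f ` set_decode p) ` G. B \<union> C \<subseteq> E"
      if BC: "B \<in> (\<lambda>p. f ` set_decode p) ` G" "C \<in> (\<lambda>p. f ` set_decode p) ` G" for B C
    proof -
      obtain p q where "p \<in> G" "q \<in> G" and eq: "B = f ` set_decode p" "C = f ` set_decode q"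
        using BC by blast
      then obtain s where "s \<in> G" "(s, p) \<in> r" "(s, q) \<in> r"
        using G unfolding poset_filter_def by blast
      then show ?thesis
        unfolding eq r_def by blast
    qed
  qed
  moreover have "f ` A = \<Union>((\<lambda>p. f ` set_decode p) ` G)"
    unfolding A_def by (rule image_UN)
  ultimately have "sparse h (f ` A)"
    by simp
  moreover have "AP_set (A \<inter> X)" if "X \<in> \<F>" for X
    unfolding AP_set_def
  proof
    fix k
    have "D (X, k) \<in> D ` (\<F> \<times> UNIV)"
      using that by (intro imageI SigmaI UNIV_I)
    then have "G \<inter> D (X, k) \<noteq> {}"
      using meets by (rule bspec[rotated])
    then obtain p where "p \<in> G" "p \<in> D (X, k)"
      by blast
    then obtain a d where "d > 0" "\<forall>i<k. a + i * d \<in> set_decode p \<inter> X"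
      by (auto simp: D_def)
    then show "\<exists>a d. d > 0 \<and> (\<forall>i<k. a + i * d \<in> A \<inter> X)"
      using \<open>p \<in> G\<close> unfolding A_def by blast
  qed
  ultimately show ?thesis
    by blast
qed

subsection \<open>The transfinite construction\<close>

text \<open>Recursion along a well-order of type continuum: every stage has fewer than continuum
  many predecessors, hence fewer than continuum many finite intersections of earlier sets, and
  Martin's axiom applies.\<close>

lemma exists_AP_family:
  fixes f h :: "nat set \<Rightarrow> nat \<Rightarrow> nat"
  assumes MA: "MA_countable"
  shows "\<exists>A. (\<forall>S. finite S \<longrightarrow> AP_set (\<Inter>(A ` S))) \<and>
    (\<forall>x. (\<exists>k. A x \<subseteq> f x -` {k}) \<or> sparse (h x) (f x ` A x))"
proof -
  let ?r = "|UNIV :: nat set set|"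
  have wo: "Well_order ?r"
    by (rule card_of_Well_order)
  \<comment> \<open>\<open>B\<close> is admissible at stage \<open>x\<close>. This depends on
    \<open>A\<close> only at the predecessors of \<open>x\<close>, as the well-founded choice
    principle demands.\<close>
  define P where "P A x B \<longleftrightarrow> (\<forall>S. finite S \<longrightarrow> S \<subseteq> underS ?r x \<longrightarrow> AP_set (B \<inter> \<Inter>(A ` S))) \<and>
    ((\<exists>k. B \<subseteq> f x -` {k}) \<or> sparse (h x) (f x ` B))" for A x B
  have in_underS: "y \<in> underS ?r x \<longleftrightarrow> (y, x) \<in> ?r - Id" for x y
    by (auto simp: underS_def)
  \<comment> \<open>The last index \<open>y\<close> in \<open>S\<close> decides: all others precede
    it, so admissibility of \<open>A y\<close> covers the whole intersection. As only indices in
    \<open>S\<close> are involved, this also serves during the recursion.\<close>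
  have P_AP: "AP_set (\<Inter>(A ` S))" 
    if "finite S" and PA: "\<And>y. y \<in> S \<Longrightarrow> P A y (A y)" for A S
  proof (cases "S = {}")
    case True
    then show ?thesis
      by (simp add: AP_set_UNIV)
  next
    case False
    have "\<exists>y\<in>S. \<forall>z\<in>S. (z, y) \<in> ?r"
      using that(1) False
    proof (induction S rule: finite_ne_induct)
      case (singleton x)
      show ?case
        using card_of_refl wo by (simp add: order_on_defs refl_on_def)
    next
      case (insert x F)
      then obtain y where y: "y \<in> F" "\<forall>z\<in>F. (z, y) \<in> ?r"
        by blast
      have "(x, x) \<in> ?r" "trans ?r"
        using wo by (auto simp: order_on_defs refl_on_def)
      moreover have "(x, y) \<in> ?r \<or> (y, x) \<in> ?r"
        using wo \<open>(x, x) \<in> ?r\<close> by (cases "x = y") (auto simp: order_on_defs total_on_def)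
      ultimately show ?case
        using y by (metis insert_iff transD)
    qed
    then obtain y where y: "y \<in> S" "S - {y} \<subseteq> underS ?r y"
      by (auto simp: underS_def)
    then have "AP_set (A y \<inter> \<Inter>(A ` (S - {y})))"
      using PA[OF y(1)] that(1) unfolding P_def by blast
    moreover have "A y \<inter> \<Inter>(A ` (S - {y})) = \<Inter>(A ` S)"
      using y(1) by auto
    ultimately show ?thesis
      by simp
  qed
  have "\<exists>A. \<forall>x. P A x (A x)"
  proof (rule dependent_wf_choice[of "?r - Id"])
    show "wf (?r - Id)"
      using wo by (simp add: well_order_on_def)
    show "P A x B = P A' x B" if "\<And>z. (z, x) \<in> ?r - Id \<Longrightarrow> A z = A' z" for A A' x B
    proof -
      have "A ` S = A' ` S" if "S \<subseteq> underS ?r x" for S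
        using that \<open>\<And>z. (z, x) \<in> ?r - Id \<Longrightarrow> A z = A' z\<close> in_underS by (intro image_cong) blast+
      then show ?thesis
        unfolding P_def by auto
    qed
    show "\<exists>B. P A x B" if IH: "\<And>y. (y, x) \<in> ?r - Id \<Longrightarrow> P A y (A y)" for x A
    proof -
      define \<F> where "\<F> = (\<lambda>S. \<Inter>(A ` S)) ` Fpow (underS ?r x)"
      \<comment> \<open>A proper initial segment of a cardinal has smaller cardinality.\<close>
      have less: "underS ?r x \<prec> (UNIV :: nat set set)"
        using card_of_underS[OF card_of_Card_order, of x "UNIV :: nat set set"]
        by (simp add: lesspoll_def subset_imp_lepoll eqpoll_iff_card_of_ordIso not_ordLess_ordIso)
      have "\<F> \<prec> (UNIV :: nat set set)"
      proof (cases "finite (underS ?r x)")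
        case True
        then have "finite \<F>"
          by (simp add: \<F>_def Fpow_Pow_finite)
        then show ?thesis
          by (simp add: finite_lesspoll_infinite Finite_Set.finite_set)
      next
        case False
        then have "\<F> \<lesssim> underS ?r x"
          using eqpoll_Fpow image_lepoll unfolding \<F>_def by (metis lepoll_trans2)
        then show ?thesis
          using less lesspoll_trans1 by blast
      qed
      moreover have "X \<inter> Y \<in> \<F>" if XY: "X \<in> \<F>" "Y \<in> \<F>" for X Y
      proof -
        obtain S T where "S \<in> Fpow (underS ?r x)" "X = \<Inter>(A ` S)"
          and "T \<in> Fpow (underS ?r x)" "Y = \<Inter>(A ` T)"
          using XY unfolding \<F>_def by blast
        then have "S \<union> T \<in> Fpow (underS ?r x)" "X \<inter> Y = \<Inter>(A ` (S \<union> T))"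
          by (auto simp: Fpow_def)
        then show ?thesis
          unfolding \<F>_def by blast
      qed
      moreover have "AP_set X" if "X \<in> \<F>" for X
      proof -
        obtain S where "finite S" "S \<subseteq> underS ?r x" "X = \<Inter>(A ` S)"
          using \<open>X \<in> \<F>\<close> by (auto simp: \<F>_def Fpow_def)
        then show ?thesis
          using P_AP IH in_underS by blast
      qed
      ultimately have "\<exists>B. (\<forall>X\<in>\<F>. AP_set (B \<inter> X)) \<and>
          ((\<exists>k. B \<subseteq> f x -` {k}) \<or> sparse (h x) (f x ` B))"
        by (rule MA_countable_extension[OF MA])
      then obtain B where "\<forall>X\<in>\<F>. AP_set (B \<inter> X)"
        and good: "(\<exists>k. B \<subseteq> f x -` {k}) \<or> sparse (h x) (f x ` B)"
        by (elim exE conjE)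
      then have "\<forall>S. finite S \<longrightarrow> S \<subseteq> underS ?r x \<longrightarrow> AP_set (B \<inter> \<Inter>(A ` S))"
        by (simp add: \<F>_def Fpow_def)
      then show ?thesis
        unfolding P_def using good by (intro exI[of _ B] conjI)
    qed
  qed
  then show ?thesis
  proof
    fix A
    assume A: "\<forall>x. P A x (A x)"
    then have "AP_set (\<Inter>(A ` S))" if "finite S" for S
      using P_AP that by blast
    moreover have "(\<exists>k. A x \<subseteq> f x -` {k}) \<or> sparse (h x) (f x ` A x)" for x
      using A unfolding P_def by blast
    ultimately show ?thesis
      by blast
  qed
qed

text \<open>A pair of functions is coded by its graph as a set of natural numbers; inverting this
  injection assigns a stage to every pair.\<close>

lemma exists_surj_pairs: "\<exists>g :: nat set \<Rightarrow> (nat \<Rightarrow> nat) \<times> (nat \<Rightarrow> nat). surj g"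
proof -
  have "inj (\<lambda>(f :: nat \<Rightarrow> nat, h :: nat \<Rightarrow> nat). range (\<lambda>n. prod_encode (n, prod_encode (f n, h n))))"
  proof (rule injI, clarify)
    fix f h f' h' :: "nat \<Rightarrow> nat"
    assume eq: "range (\<lambda>n. prod_encode (n, prod_encode (f n, h n))) =
      range (\<lambda>n. prod_encode (n, prod_encode (f' n, h' n)))"
    have "f n = f' n \<and> h n = h' n" for n
    proof -
      have "prod_encode (n, prod_encode (f n, h n)) \<in>
          range (\<lambda>n. prod_encode (n, prod_encode (f' n, h' n)))"
        unfolding eq[symmetric] by blast
      then show ?thesis
        by (auto simp: prod_encode_eq)
    qed
    then show "f = f' \<and> h = h'"
      by auto
  qed
  then show ?thesis
    using inj_imp_surj_inv by blast
qed

section \<open>The ultrafilter generated by the family\<close>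

lemma filter_sets_mono: "A \<in> filter_sets F \<Longrightarrow> A \<subseteq> B \<Longrightarrow> B \<in> filter_sets F"
  by (auto simp: filter_sets_def elim: eventually_mono)

lemma ultrafilter_filtermap: "ultrafilter U \<Longrightarrow> ultrafilter (filtermap f U)"
  unfolding ultrafilter_def filter_sets_def
  by (force simp: filtermap_bot_iff eventually_filtermap dest: spec[of _ "f -` _"])

text \<open>If no singleton from \<open>B\<close> were a member, the finitely many complements would
  intersect \<open>B\<close> in the empty set. Hence all members of a nonprincipal ultrafilter are
  infinite.\<close>

lemma ultrafilter_finite_imp_principal:
  assumes U: "ultrafilter U" and B: "B \<in> filter_sets U" "finite B"
  shows "\<exists>x. U = principal {x}"
proof -
  have "\<exists>x\<in>B. {x} \<in> filter_sets U"
  proof (rule ccontr)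
    assume "\<not> ?thesis"
    then have "\<forall>x\<in>B. - {x} \<in> filter_sets U"
      using U unfolding ultrafilter_def by blast
    then have "\<forall>x\<in>B. \<forall>\<^sub>F y in U. y \<noteq> x"
      by (simp add: filter_sets_def)
    then have "\<forall>\<^sub>F y in U. \<forall>x\<in>B. y \<noteq> x"
      by (rule eventually_ball_finite[OF B(2)])
    moreover have "\<forall>\<^sub>F y in U. y \<in> B"
      using B(1) by (simp add: filter_sets_def)
    ultimately have "\<forall>\<^sub>F y in U. False"
      by eventually_elim blast
    then show False
      using U by (simp add: ultrafilter_def trivial_limit_def)
  qed
  then obtain x where x: "\<forall>\<^sub>F y in U. y = x"
    by (auto simp: filter_sets_def)
  have "eventually Q U \<longleftrightarrow> Q x" for Q
  proof
    assume "eventually Q U"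
    then have "\<forall>\<^sub>F y in U. Q x"
      using x by eventually_elim simp
    then show "Q x"
      using U by (simp add: ultrafilter_def eventually_const)
  next
    assume "Q x"
    then show "eventually Q U"
      using eventually_mono[OF x] by blast
  qed
  then have "U = principal {x}"
    by (simp add: filter_eq_iff eventually_principal)
  then show ?thesis ..
qed

theorem theorem3p4:
  assumes "MA_countable"
  shows "\<exists>U :: nat filter. hereditarily_rapid U \<and> filter_sets U \<inter> vdW_ideal = {}"
proof -
  obtain g :: "nat set \<Rightarrow> (nat \<Rightarrow> nat) \<times> (nat \<Rightarrow> nat)" where g: "surj g"
    using exists_surj_pairs by blast
  obtain A where A: "\<And>S. finite S \<Longrightarrow> AP_set (\<Inter>(A ` S))"
    and A': "\<And>x. (\<exists>k. A x \<subseteq> fst (g x) -` {k}) \<or> sparse (snd (g x)) (fst (g x) ` A x)"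
    using exists_AP_family[OF assms, of "\<lambda>x. fst (g x)" "\<lambda>x. snd (g x)"] by meson
  define U where "U = (INF x. principal (A x))"
  \<comment> \<open>Members of an infimum of principal filters contain finite intersections of the
    generators.\<close>
  have "\<exists>S. finite S \<and> \<Inter>(A ` S) \<subseteq> B" if "B \<in> filter_sets U" for B
    using that unfolding U_def filter_sets_def
    by (auto simp: eventually_INF[where B = UNIV] INF_principal_finite eventually_principal)
  then have AP: "AP_set B" if "B \<in> filter_sets U" for B
    using that A AP_set_mono by meson
  have A_in: "A x \<in> filter_sets U" for x
    unfolding filter_sets_def U_def
    by (auto intro!: eventually_INF1[of x] simp: eventually_principal)
  have dich: "\<exists>C\<in>filter_sets U. (\<exists>k. C \<subseteq> f -` {k}) \<or> sparse h (f ` C)" for f h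
  proof -
    obtain x where "g x = (f, h)"
      using g by (metis surjD)
    then show ?thesis
      using A'[of x] A_in[of x] by auto
  qed
  have not_bot: "U \<noteq> bot"
    using AP[of "{}"] not_AP_set_empty by (auto simp: filter_sets_def)
  have ultra: "ultrafilter U"
    unfolding ultrafilter_def
  proof (intro conjI allI not_bot)
    fix B
    let ?f = "\<lambda>x :: nat. of_bool (x \<in> B) :: nat"
    obtain C where C: "C \<in> filter_sets U" "(\<exists>k. C \<subseteq> ?f -` {k}) \<or> sparse (\<lambda>_. 2) (?f ` C)"
      using dich by blast
    \<comment> \<open>Sparsity at \<open>n = 0\<close> forbids values below 2, but an indicator
      function has no others. So the indicator is constant on \<open>C\<close>, which decides
      \<open>B\<close>.\<close>
    have "\<not> sparse (\<lambda>_. 2) (?f ` C)"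
    proof
      assume "sparse (\<lambda>_. 2) (?f ` C)"
      then have "?f ` C \<inter> {..<2} = {}"
        unfolding sparse_def by (metis card_0_eq finite_Int finite_lessThan le_zero_eq)
      then have "C = {}"
        by auto
      then show False
        using AP[OF C(1)] not_AP_set_empty by simp
    qed
    then obtain k where "C \<subseteq> ?f -` {k}"
      using C(2) by blast
    then have "C \<subseteq> B \<or> C \<subseteq> - B"
      by (cases "k = 0") (auto split: if_splits)
    then show "B \<in> filter_sets U \<or> - B \<in> filter_sets U"
      using C(1) filter_sets_mono by blast
  qed
  have rapid: "rapid (filtermap f U)" if "nonprincipal (filtermap f U)" for f
    unfolding rapid_def
  proof (intro conjI allI that ultrafilter_filtermap ultra)
    fix h :: "nat \<Rightarrow> nat"
    obtain C where C: "C \<in> filter_sets U" "(\<exists>k. C \<subseteq> f -` {k}) \<or> sparse h (f ` C)"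
      using dich by blast
    have "f ` C \<in> filter_sets (filtermap f U)"
      using C(1) by (auto simp: filter_sets_filtermap)
    moreover from this have inf: "infinite (f ` C)"
      using ultrafilter_finite_imp_principal ultrafilter_filtermap ultra that
      unfolding nonprincipal_def by blast
    \<comment> \<open>An infinite image excludes the alternative that \<open>f\<close> is constant
      on \<open>C\<close>.\<close>
    moreover have "sparse h (f ` C)"
    proof -
      have "f ` C \<subseteq> {k}" if "C \<subseteq> f -` {k}" for k
        using that by blast
      then show ?thesis
        using C(2) inf by (meson finite.emptyI finite_insert finite_subset)
    qed
    ultimately show "\<exists>B\<in>filter_sets (filtermap f U). infinite B \<and>
        (\<forall>\<^sub>F n in sequentially. h n \<le> enumerate B n)"
      using sparse_le_enumerate by (intro bexI[of _ "f ` C"]) auto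
  qed
  have "nonprincipal U"
    unfolding nonprincipal_def
  proof clarify
    fix x
    assume "U = principal {x}"
    then show False
      using AP[of "{x}"] not_AP_set_singleton by (simp add: filter_sets_def eventually_principal)
  qed
  \<comment> \<open>\<open>U\<close> is its own image under the identity.\<close>
  then have "rapid U"
    using rapid[of "\<lambda>x. x"] by simp
  then have "hereditarily_rapid U"
    using rapid by (simp add: hereditarily_rapid_def)
  then show ?thesis
    using AP by (auto simp: vdW_ideal_def)
qed

end
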